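(* Consider the attitude error dynamics of a rigid spacecraft $$\dot{\boldsymbol q}_{\mathrm e}=\tfrac12\begin{bmatrix}-\boldsymbol q_{\mathrm{ev}}^{\mathrm T}\\ q_{\mathrm e0}I_3+\boldsymbol q_{\mathrm{ev}}^{\times}\end{bmatrix}\boldsymbol\omega_{\mathrm e},\qquad J\dot{\boldsymbol\omega}_{\mathrm e}=-\boldsymbol\omega_{\mathrm e}^{\times}J\boldsymbol\omega_{\mathrm e}+\boldsymbol u+\boldsymbol d ,$$ where $\boldsymbol q_{\mathrm e}=[q_{\mathrm e0}\ \boldsymbol q_{\mathrm{ev}}^{\mathrm T}]^{\mathrm T}$ is a unit quaternion, and the switching function $$\boldsymbol s=\boldsymbol\omega_{\mathrm e}+\lambda\boldsymbol\sigma,\qquad \boldsymbol\sigma=\sinh(q_{\mathrm e0})\,\boldsymbol q_{\mathrm{ev}},$$ with $\lambda$ a positive constant. If the system states of the attitude error dynamics are restricted to the switching surface $\boldsymbol s=0$, then the following conclusions are achieved: (i) The switching surface $\boldsymbol s=0$ contains two equilibria $q_{\mathrm e0}=1$ and $q_{\mathrm e0}=-1$, and the control goal $$\lim_{t\to\infty}q_{\mathrm e0}=1\ \text{or}\ -1,\qquad \lim_{t\to\infty}\boldsymbol\omega_{\mathrm e}=0$$ is guaranteed. (ii) The unwinding phenomenon is avoided in the sliding phase (i.e. while the system states are on the switching surface $\boldsymbol s=0$).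
   Context: The error quaternion $\boldsymbol q_{\mathrm e}=[q_{\mathrm e0}\ \boldsymbol q_{\mathrm{ev}}^{\mathrm T}]^{\mathrm T}\in\mathbb R\times\mathbb R^3$ describes the attitude of the spacecraft body frame relative to the desired frame and satisfies $q_{\mathrm e0}^2+\boldsymbol q_{\mathrm{ev}}^{\mathrm T}\boldsymbol q_{\mathrm{ev}}=1$. The vector $\boldsymbol\omega_{\mathrm e}\in\mathbb R^3$ is the angular velocity error, $J\in\mathbb R^{3\times3}$ is the symmetric inertia matrix of the spacecraft, $\boldsymbol u\in\mathbb R^3$ is the control torque, $\boldsymbol d\in\mathbb R^3$ is the external disturbance, and $I_3$ is the $3\times 3$ identity matrix. For $\boldsymbol x\in\mathbb R^3$, $$\boldsymbol x^{\times}=\begin{bmatrix} 0 & -x_3 & x_2 \\ x_3 & 0 & -x_1 \\ -x_2 & x_1 & 0 \end{bmatrix}.$$ Unwinding phenomenon: the error quaternion can be written as $q_{\mathrm e0}=\cos\frac{\theta(t)}2$, $\boldsymbol q_{\mathrm{ev}}=\boldsymbol e\sin\frac{\theta(t)}2$, with rotation angle $\theta(t)=2\arccos q_{\mathrm e0}\in[0,2\pi]$ and $\boldsymbol e\in\mathbb R^3$ the fixed Euler axis. The values $\theta=0$ ($q_{\mathrm e0}=1$) and $\theta=2\pi$ ($q_{\mathrm e0}=-1$) represent the same physical attitude, so both are equilibrium points. If a controller treats only $q_{\mathrm e0}=1$ as equilibrium, then when the initial value of $q_{\mathrm e0}$ is less than $0$ it drives $q_{\mathrm e0}$ to $0$ and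 finally to $1$, so that the spacecraft rotates through an Euler angle larger than $\pi$, although it could reach the desired attitude by rotating through an angle smaller than $\pi$. This is called the unwinding phenomenon.
   Formalization: The limit of q_e0 to 1 or -1 is claimed only when q_e0 is nonzero at the start of the sliding phase; if q_e0 = 0 there, the state with ω_e = 0 and u = -d rests on s = 0 forever, so the original limit claim fails. *)

theory Defs
  imports "HOL-Analysis.Analysis"
begin

definition cross_matrix :: "real^3 \<Rightarrow> real^3^3" where
  "cross_matrix x = vector [vector [0, - x$3, x$2],
                            vector [x$3, 0, - x$1],
                            vector [- x$2, x$1, 0]]"

type_synonym quat = "real \<times> (real^3)"

definition unit_quat :: "quat \<Rightarrow> bool" where
  "unit_quat q \<longleftrightarrow> (fst q)\<^sup>2 + snd q \<bullet> snd q = 1"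

definition quat_rate :: "quat \<Rightarrow> real^3 \<Rightarrow> quat" where
  "quat_rate q w =
     (1/2) *\<^sub>R (- (snd q \<bullet> w), (fst q *\<^sub>R mat 1 + cross_matrix (snd q)) *v w)"

text \<open>The control \<open>u\<close> and the disturbance \<open>d\<close> are arbitrary time signals; a feedback law enters
  through the signal it produces along the trajectory.\<close>

definition attitude_error_dynamics ::
  "real^3^3 \<Rightarrow> (real \<Rightarrow> real^3) \<Rightarrow> (real \<Rightarrow> real^3) \<Rightarrow> real \<Rightarrow> (real \<Rightarrow> quat) \<Rightarrow> (real \<Rightarrow> real^3) \<Rightarrow> bool"
where
  "attitude_error_dynamics J u d t0 q w \<longleftrightarrow>
     (\<forall>t\<ge>t0. unit_quat (q t)
        \<and> (q has_vector_derivative quat_rate (q t) (w t)) (at t within {t0..})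
        \<and> (\<exists>w'. (w has_vector_derivative w') (at t within {t0..})
              \<and> J *v w' = - (cross_matrix (w t) *v (J *v w t)) + u t + d t))"

definition switching_function :: "real \<Rightarrow> quat \<Rightarrow> real^3 \<Rightarrow> real^3" where
  "switching_function lam q w = w + lam *\<^sub>R (sinh (fst q) *\<^sub>R snd q)"

definition sliding_motion ::
  "real^3^3 \<Rightarrow> real \<Rightarrow> (real \<Rightarrow> real^3) \<Rightarrow> (real \<Rightarrow> real^3) \<Rightarrow> real \<Rightarrow> (real \<Rightarrow> quat) \<Rightarrow> (real \<Rightarrow> real^3) \<Rightarrow> bool"
where
  "sliding_motion J lam u d t0 q w \<longleftrightarrow>
     attitude_error_dynamics J u d t0 q w \<and> (\<forall>t\<ge>t0. switching_function lam (q t) (w t) = 0)"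

text \<open>A state is an equilibrium on the switching surface if resting there is a sliding motion.
  The control is existentially quantified because a sliding motion determines it
  (the equivalent control).\<close>

definition sliding_equilibrium ::
  "real^3^3 \<Rightarrow> real \<Rightarrow> (real \<Rightarrow> real^3) \<Rightarrow> real \<Rightarrow> quat \<Rightarrow> real^3 \<Rightarrow> bool" where
  "sliding_equilibrium J lam d t0 q w \<longleftrightarrow>
     (\<exists>u. sliding_motion J lam u d t0 (\<lambda>_. q) (\<lambda>_. w))"

definition rotation_angle :: "quat \<Rightarrow> real" where
  "rotation_angle q = 2 * arccos (fst q)"

text \<open>Angles \<open>0\<close> and \<open>2 * pi\<close> are the same attitude, so the shortest rotation to the desired
  attitude is \<open>min \<theta> (2 * pi - \<theta>)\<close>. Unwinding means that the total angle travelled after \<open>t0\<close>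
  (the variation of the rotation angle) exceeds \<open>pi\<close> although this shortest rotation is less
  than \<open>pi\<close>. The lemma below shows that a motion driven from a negative scalar part through
  zero to one is unwinding in this sense.\<close>

definition unwinding :: "real \<Rightarrow> (real \<Rightarrow> quat) \<Rightarrow> bool" where
  "unwinding t0 q \<longleftrightarrow>
     min (rotation_angle (q t0)) (2 * pi - rotation_angle (q t0)) < pi \<and>
     (\<exists>(\<tau> :: nat \<Rightarrow> real) n. mono \<tau> \<and> t0 \<le> \<tau> 0 \<and>
        (\<Sum>i<n. \<bar>rotation_angle (q (\<tau> (Suc i))) - rotation_angle (q (\<tau> i))\<bar>) > pi)"

lemma unwinding_if_driven_through_zero:
  assumes unit: "\<And>t. t \<ge> t0 \<Longrightarrow> unit_quat (q t)"
    and neg: "fst (q t0) < 0"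
    and zero: "\<exists>t\<ge>t0. fst (q t) = 0"
    and lim: "((\<lambda>t. fst (q t)) \<longlongrightarrow> 1) at_top"
  shows "unwinding t0 q"
proof -
  have bnd: "- 1 \<le> fst (q t) \<and> fst (q t) \<le> 1" if "t \<ge> t0" for t
  proof -
    have "(fst (q t))\<^sup>2 \<le> 1"
      using unit[OF that] inner_ge_zero[of "snd (q t)"] unfolding unit_quat_def by linarith
    then show ?thesis
      by (simp add: abs_square_le_1 abs_le_iff)
  qed
  define a where "a = rotation_angle (q t0)"
  have a: "a > pi"
    using arccos_less_mono[of 0 "fst (q t0)"] bnd[of t0] neg
    by (simp add: a_def rotation_angle_def)
  define c where "c = cos ((a - pi) / 2)"
  have a2: "a \<le> 2 * pi"
    using arccos_ubound[of "fst (q t0)"] bnd[of t0] by (simp add: a_def rotation_angle_def)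
  have c: "c < 1"
    using cos_monotone_0_pi[of 0 "(a - pi) / 2"] a a2 by (simp add: c_def)
  have "eventually (\<lambda>t. fst (q t) > c \<and> t \<ge> t0) at_top"
    using order_tendstoD(1)[OF lim c] eventually_ge_at_top[of t0] by eventually_elim auto
  then obtain t1 where t1: "fst (q t1) > c" "t1 \<ge> t0"
    using eventually_happens'[OF trivial_limit_at_top_linorder] by blast
  have "c \<ge> - 1" by (simp add: c_def)
  then have "arccos (fst (q t1)) < arccos c"
    using arccos_less_mono[of "fst (q t1)" c] bnd[of t1] t1 c by simp
  also have "arccos c = (a - pi) / 2"
    using a a2 unfolding c_def by (intro arccos_cos) auto
  finally have r: "rotation_angle (q t1) < a - pi"
    by (simp add: rotation_angle_def)
  have "mono (\<lambda>i::nat. if i = 0 then t0 else t1)"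
    using t1 by (auto simp: mono_def)
  moreover have "(\<Sum>i<(1::nat). \<bar>rotation_angle (q (if Suc i = 0 then t0 else t1))
      - rotation_angle (q (if i = 0 then t0 else t1))\<bar>) > pi"
    using r by (simp add: a_def)
  ultimately have "\<exists>(\<tau> :: nat \<Rightarrow> real) n. mono \<tau> \<and> t0 \<le> \<tau> 0 \<and>
        (\<Sum>i<n. \<bar>rotation_angle (q (\<tau> (Suc i))) - rotation_angle (q (\<tau> i))\<bar>) > pi"
    by (intro exI[of _ "\<lambda>i. if i = 0 then t0 else t1"] exI[of _ 1]) simp
  then show ?thesis
    using a by (simp add: unwinding_def a_def)
qed

end

theory Submission
  imports Defs
begin

text \<open>On the surface \<open>s = 0\<close> the scalar part \<open>x\<close> of the quaternion obeys the autonomous equation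
  \<open>x' = (lam/2) sinh x (1 - x\<^sup>2)\<close>. Hence \<open>x\<^sup>2\<close> never decreases, and once it is positive \<open>1 - x\<^sup>2\<close>
  decays exponentially, because \<open>x sinh x \<ge> x\<^sup>2\<close>. A scalar part that starts away from zero
  therefore keeps its sign and tends to \<open>1\<close> or \<open>-1\<close>, while the rotation angle moves monotonically
  within \<open>[0, \<pi>]\<close> or within \<open>[\<pi>, 2\<pi>]\<close>, so that it travels at most \<open>\<pi>\<close>. If \<open>x\<close> starts at zero,
  either it becomes nonzero at some time, and the convergence argument restarts there, or it stays
  zero and so does \<open>\<omega>\<close>.\<close>

section \<open>Two facts of real analysis\<close>

lemma square_le_mult_sinh: "x\<^sup>2 \<le> x * sinh x" for x :: real
proof -
  have "\<bar>x\<bar> \<le> \<bar>sinh x\<bar>"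
    using real_le_abs_sinh[of x] by (simp add: sinh_field_def exp_minus)
  then have "\<bar>x\<bar> * \<bar>x\<bar> \<le> \<bar>x\<bar> * sinh \<bar>x\<bar>"
    by (intro mult_left_mono) auto
  then show ?thesis
    by (cases "x \<ge> 0") (auto simp: power2_eq_square)
qed

text \<open>The derivative at \<open>a\<close> is only one-sided. It becomes two-sided strictly
  between \<open>r\<close> and \<open>s\<close>, and continuity suffices at these endpoints.\<close>

lemma DERIV_within_nonneg_imp_mono_on:
  fixes f f' :: "real \<Rightarrow> real"
  assumes der: "\<And>t. t \<ge> a \<Longrightarrow> (f has_real_derivative f' t) (at t within {a..})"
    and nonneg: "\<And>t. t \<ge> a \<Longrightarrow> f' t \<ge> 0"
  shows "mono_on {a..} f"
proof (rule mono_onI)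
  fix r s assume rs: "r \<in> {a..}" "s \<in> {a..}" "r \<le> s"
  show "f r \<le> f s"
  proof (rule DERIV_nonneg_imp_increasing_open[OF \<open>r \<le> s\<close>])
    fix t assume t: "r < t" "t < s"
    then have "at t within {a..} = at t"
      using rs by (intro at_within_interior) auto
    then show "\<exists>y. (f has_real_derivative y) (at t) \<and> 0 \<le> y"
      using der[of t] nonneg[of t] rs t by (intro exI[of _ "f' t"]) auto
  next
    have "continuous_on {a..} f"
      using der by (intro DERIV_continuous_on) auto
    then show "continuous_on {r..s} f"
      by (rule continuous_on_subset) (use rs in auto)
  qed
qed

section \<open>The autonomous scalar equation\<close>

locale sliding_scalar =
  fixes x :: "real \<Rightarrow> real" and lam t0 :: real
  assumes lam_pos: "lam > 0"
    and deriv: "\<And>t. t \<ge> t0 \<Longrightarrow>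
      (x has_real_derivative lam / 2 * sinh (x t) * (1 - (x t)\<^sup>2)) (at t within {t0..})"
    and square_le_1: "\<And>t. t \<ge> t0 \<Longrightarrow> (x t)\<^sup>2 \<le> 1"
begin

lemma abs_le_1: "t \<ge> t0 \<Longrightarrow> \<bar>x t\<bar> \<le> 1"
  using square_le_1[of t] by (simp add: abs_square_le_1)

lemma deriv_square:
  assumes "t \<ge> t0"
  shows "((\<lambda>t. (x t)\<^sup>2) has_real_derivative lam * (x t * sinh (x t)) * (1 - (x t)\<^sup>2))
    (at t within {t0..})"
  by (rule derivative_eq_intros deriv[OF assms] refl)+ (simp add: field_simps)

lemma square_mono: "mono_on {t0..} (\<lambda>t. (x t)\<^sup>2)"
proof (rule DERIV_within_nonneg_imp_mono_on[OF deriv_square])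
  fix t assume "t \<ge> t0"
  moreover have "0 \<le> x t * sinh (x t)"
    using square_le_mult_sinh[of "x t"] by (meson order_trans zero_le_power2)
  ultimately show "0 \<le> lam * (x t * sinh (x t)) * (1 - (x t)\<^sup>2)"
    using lam_pos square_le_1 by simp
qed

text \<open>The equation is autonomous, so any later time can serve as the initial time. This covers
  a scalar part that starts at zero and leaves it later.\<close>

lemma sliding_scalar_restart:
  assumes "t0 \<le> t1"
  shows "sliding_scalar x lam t1"
proof
  fix t assume "t \<ge> t1"
  then show "(x has_real_derivative lam / 2 * sinh (x t) * (1 - (x t)\<^sup>2)) (at t within {t1..})"
    using assms by (intro DERIV_subset[OF deriv]) auto
  show "(x t)\<^sup>2 \<le> 1" using square_le_1 assms \<open>t \<ge> t1\<close> by simp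
qed (rule lam_pos)

text \<open>A Gronwall argument: y = 1 - x^2 satisfies y' \<le> -k y, so y exp(k t) never increases.
  The function \<open>f\<close> is its negative, which makes the monotonicity lemma
  applicable.\<close>

lemma square_tendsto_1_if_start:
  assumes "x t0 \<noteq> 0"
  shows "((\<lambda>t. (x t)\<^sup>2) \<longlongrightarrow> 1) at_top"
proof -
  \<comment> \<open>The decay rate: x^2 never falls below its initial value, so \<open>k\<close>
    stays below \<open>lam * (x t * sinh (x t))\<close> at all later times.\<close>
  define k where "k = lam * (x t0)\<^sup>2"
  have k: "k > 0" using assms lam_pos by (simp add: k_def)
  define f where "f = (\<lambda>t. ((x t)\<^sup>2 - 1) * exp (k * t))"
  have "mono_on {t0..} f"
  proof (rule DERIV_within_nonneg_imp_mono_on)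
    fix t assume t: "t \<ge> t0"
    show "(f has_real_derivative
        (lam * (x t * sinh (x t)) - k) * ((1 - (x t)\<^sup>2) * exp (k * t))) (at t within {t0..})"
      unfolding f_def
      by (rule derivative_eq_intros deriv_square[OF t] refl)+ (simp add: algebra_simps)
    have "(x t0)\<^sup>2 \<le> x t * sinh (x t)"
      using mono_onD[OF square_mono, of t0 t] square_le_mult_sinh[of "x t"] t by simp
    then have "k \<le> lam * (x t * sinh (x t))"
      using lam_pos by (simp add: k_def)
    then show "0 \<le> (lam * (x t * sinh (x t)) - k) * ((1 - (x t)\<^sup>2) * exp (k * t))"
      using square_le_1[OF t] by simp
  qed
  then have f_ge: "f t0 \<le> f t" if "t \<ge> t0" for t
    using that by (auto dest: mono_onD)
  have lower: "1 + f t0 * exp (- (k * t)) \<le> (x t)\<^sup>2" if "t \<ge> t0" for t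
  proof -
    have "f t0 * exp (- (k * t)) \<le> f t * exp (- (k * t))"
      using f_ge[OF that] by simp
    also have "\<dots> = (x t)\<^sup>2 - 1"
      by (simp add: f_def exp_minus)
    finally show ?thesis by simp
  qed
  have "filterlim (\<lambda>t. k * t) at_top at_top"
    by (rule filterlim_tendsto_pos_mult_at_top[OF tendsto_const k filterlim_ident])
  then have "((\<lambda>t. exp (- (k * t))) \<longlongrightarrow> 0) at_top"
    by (intro filterlim_compose[OF exp_at_bot])
       (simp add: filterlim_uminus_at_top[symmetric])
  then have "((\<lambda>t. 1 + f t0 * exp (- (k * t))) \<longlongrightarrow> 1 + f t0 * 0) at_top"
    by (intro tendsto_intros)
  then have "((\<lambda>t. 1 + f t0 * exp (- (k * t))) \<longlongrightarrow> 1) at_top" by simp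
  then show ?thesis
  proof (rule tendsto_sandwich[rotated 2])
    show "\<forall>\<^sub>F t in at_top. 1 + f t0 * exp (- (k * t)) \<le> (x t)\<^sup>2"
      by (rule eventually_at_top_linorderI) (rule lower)
    show "\<forall>\<^sub>F t in at_top. (x t)\<^sup>2 \<le> 1"
      by (rule eventually_at_top_linorderI) (rule square_le_1)
  qed simp
qed

lemma square_tendsto_1:
  assumes "t1 \<ge> t0" "x t1 \<noteq> 0"
  shows "((\<lambda>t. (x t)\<^sup>2) \<longlongrightarrow> 1) at_top"
  using assms by (intro sliding_scalar.square_tendsto_1_if_start[OF sliding_scalar_restart])

lemma nonzero:
  assumes "x t0 \<noteq> 0" "t \<ge> t0"
  shows "x t \<noteq> 0"
proof -
  have "0 < (x t0)\<^sup>2" using assms by simp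
  also have "\<dots> \<le> (x t)\<^sup>2"
    using mono_onD[OF square_mono, of t0 t] assms by simp
  finally show ?thesis by simp
qed

text \<open>The continuous image of a half-line is an interval. As it misses zero, it lies on one
  side of it.\<close>

lemma keeps_sign:
  assumes "x t0 \<noteq> 0"
  obtains "\<And>t. t \<ge> t0 \<Longrightarrow> x t > 0" | "\<And>t. t \<ge> t0 \<Longrightarrow> x t < 0"
proof -
  have "continuous_on {t0..} x"
    using deriv by (intro DERIV_continuous_on) auto
  then have "is_interval (x ` {t0..})"
    by (simp add: is_interval_connected_1 connected_continuous_image is_interval_ci)
  moreover have "0 \<notin> x ` {t0..}"
    using nonzero[OF assms] by force
  ultimately have "(\<forall>t\<ge>t0. x t > 0) \<or> (\<forall>t\<ge>t0. x t < 0)"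
    unfolding is_interval_1 by (smt (verit) atLeast_iff imageI)
  then show thesis using that by blast
qed

lemma tendsto_1_or_minus_1:
  assumes "x t0 \<noteq> 0"
  shows "(x \<longlongrightarrow> 1) at_top \<or> (x \<longlongrightarrow> - 1) at_top"
proof -
  have lim: "((\<lambda>t. \<bar>x t\<bar>) \<longlongrightarrow> 1) at_top"
    using tendsto_real_sqrt[OF square_tendsto_1[OF order_refl assms]] by simp
  show ?thesis
  proof (rule keeps_sign[OF assms])
    assume pos: "\<And>t. t \<ge> t0 \<Longrightarrow> x t > 0"
    have "\<forall>\<^sub>F t in at_top. \<bar>x t\<bar> = x t"
      using pos by (intro eventually_at_top_linorderI[of t0]) (simp add: less_imp_le)
    then show ?thesis using lim by (auto dest: tendsto_cong)
  next
    assume neg: "\<And>t. t \<ge> t0 \<Longrightarrow> x t < 0"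
    have "\<forall>\<^sub>F t in at_top. - \<bar>x t\<bar> = x t"
      using neg by (intro eventually_at_top_linorderI[of t0]) (simp add: abs_of_neg)
    then show ?thesis using tendsto_minus[OF lim] by (auto dest: tendsto_cong)
  qed
qed

text \<open>Since |x| never decreases, arccos |x| never increases. The sum of absolute increments
  therefore telescopes, and arccos |x| takes values in [0, pi/2].\<close>

lemma arccos_variation_le:
  fixes \<tau> :: "nat \<Rightarrow> real"
  assumes "x t0 \<noteq> 0" "mono \<tau>" "t0 \<le> \<tau> 0"
  shows "(\<Sum>i<n. \<bar>arccos (x (\<tau> (Suc i))) - arccos (x (\<tau> i))\<bar>) \<le> pi / 2"
proof -
  define a where "a = (\<lambda>i. arccos \<bar>x (\<tau> i)\<bar>)"
  have ge: "t0 \<le> \<tau> i" for i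
    using assms(3) monoD[OF assms(2), of 0 i] by simp
  have dec: "a (Suc i) \<le> a i" for i
  proof -
    have "(x (\<tau> i))\<^sup>2 \<le> (x (\<tau> (Suc i)))\<^sup>2"
      using mono_onD[OF square_mono, of "\<tau> i" "\<tau> (Suc i)"] monoD[OF assms(2), of i "Suc i"] ge
      by simp
    then have "\<bar>x (\<tau> i)\<bar> \<le> \<bar>x (\<tau> (Suc i))\<bar>"
      by (simp add: abs_le_square_iff)
    then show ?thesis
      unfolding a_def using abs_le_1[OF ge] by (intro arccos_le_arccos) auto
  qed
  have eq: "\<bar>arccos (x (\<tau> (Suc i))) - arccos (x (\<tau> i))\<bar> = a i - a (Suc i)" for i
  proof (rule keeps_sign[OF assms(1)])
    assume "\<And>t. t \<ge> t0 \<Longrightarrow> x t > 0"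
    then show ?thesis using dec[of i] ge by (simp add: a_def less_imp_le)
  next
    assume neg: "\<And>t. t \<ge> t0 \<Longrightarrow> x t < 0"
    \<comment> \<open>On the negative branch the angle is reflected at pi/2, which turns decrease
      into increase but keeps the size of each increment.\<close>
    have "arccos (x (\<tau> j)) = pi - a j" for j
      using arccos_minus[of "\<bar>x (\<tau> j)\<bar>"] abs_le_1[OF ge[of j]] neg[OF ge[of j]]
      by (simp add: a_def)
    then show ?thesis using dec[of i] by simp
  qed
  have "(\<Sum>i<n. a i - a (Suc i)) = a 0 - a n"
    by (rule sum_lessThan_telescope')
  moreover have "a 0 \<le> pi / 2"
    using arccos_le_arccos[of 0 "\<bar>x (\<tau> 0)\<bar>"] abs_le_1[OF ge[of 0]] by (simp add: a_def)
  moreover have "0 \<le> a n"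
    using abs_le_1[OF ge[of n]] by (simp add: a_def arccos_lbound)
  ultimately show ?thesis by (simp add: eq)
qed

end

section \<open>Transfer to sliding motions\<close>

lemma sliding_motion_surface:
  assumes "sliding_motion J lam u d t0 q w" "t \<ge> t0"
  shows "w t = - (lam * sinh (fst (q t))) *\<^sub>R snd (q t)"
    and "snd (q t) \<bullet> snd (q t) = 1 - (fst (q t))\<^sup>2"
  using assms
  by (auto simp: sliding_motion_def switching_function_def attitude_error_dynamics_def
      unit_quat_def eq_neg_iff_add_eq_0 algebra_simps)

text \<open>The scalar row of the kinematics is -(1/2) q_v . w. Substituting w from s = 0 gives
  (lam/2) sinh(q_0) |q_v|^2, and the unit norm replaces |q_v|^2 by 1 - q_0^2.\<close>

lemma sliding_scalar_if_sliding_motion: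
  assumes "sliding_motion J lam u d t0 q w" "lam > 0"
  shows "sliding_scalar (\<lambda>t. fst (q t)) lam t0"
proof
  fix t assume t: "t \<ge> t0"
  note surface = sliding_motion_surface[OF assms(1) t]
  have "(q has_vector_derivative quat_rate (q t) (w t)) (at t within {t0..})"
    using assms(1) t by (simp add: sliding_motion_def attitude_error_dynamics_def)
  then have "((\<lambda>t. fst (q t)) has_real_derivative fst (quat_rate (q t) (w t))) (at t within {t0..})"
    unfolding has_real_derivative_iff_has_vector_derivative
    by (rule bounded_linear.has_vector_derivative[OF bounded_linear_fst])
  moreover have "fst (quat_rate (q t) (w t)) =
      lam / 2 * sinh (fst (q t)) * (1 - (fst (q t))\<^sup>2)"
    by (simp add: quat_rate_def surface)
  ultimately show "((\<lambda>t. fst (q t)) has_real_derivative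
      lam / 2 * sinh (fst (q t)) * (1 - (fst (q t))\<^sup>2)) (at t within {t0..})"
    by simp
  show "(fst (q t))\<^sup>2 \<le> 1"
    using surface(2) inner_ge_zero[of "snd (q t)"] by linarith
qed (rule assms(2))

lemma sliding_motion_velocity_tendsto_0:
  assumes "sliding_motion J lam u d t0 q w" "lam > 0"
  shows "(w \<longlongrightarrow> 0) at_top"
proof -
  interpret sliding_scalar "\<lambda>t. fst (q t)" lam t0
    by (rule sliding_scalar_if_sliding_motion[OF assms])
  note surface = sliding_motion_surface[OF assms(1)]
  show ?thesis
  proof (cases "\<exists>t\<ge>t0. fst (q t) \<noteq> 0")
    case True
    then have "((\<lambda>t. (fst (q t))\<^sup>2) \<longlongrightarrow> 1) at_top"
      using square_tendsto_1 by blast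
    then have "((\<lambda>t. lam * sinh 1 * sqrt (1 - (fst (q t))\<^sup>2)) \<longlongrightarrow> lam * sinh 1 * sqrt (1 - 1)) at_top"
      by (intro tendsto_intros)
    then have lim: "((\<lambda>t. lam * sinh 1 * sqrt (1 - (fst (q t))\<^sup>2)) \<longlongrightarrow> 0) at_top" by simp
    \<comment> \<open>The unit norm gives |q_v| = sqrt(1 - q_0^2), and sinh is monotone with |q_0|
      \<le> 1.\<close>
    have "norm (w t) \<le> lam * sinh 1 * sqrt (1 - (fst (q t))\<^sup>2)" if t: "t \<ge> t0" for t
    proof -
      have eq: "norm (w t) = lam * \<bar>sinh (fst (q t))\<bar> * sqrt (1 - (fst (q t))\<^sup>2)"
        using assms(2) surface(2)[OF t]
        by (simp add: surface(1)[OF t] norm_eq_sqrt_inner[of "snd (q t)"] abs_mult)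
      have "\<bar>sinh (fst (q t))\<bar> \<le> sinh 1"
        using abs_le_1[OF t] sinh_real_le_iff sinh_real_abs by metis
      then have "lam * \<bar>sinh (fst (q t))\<bar> * sqrt (1 - (fst (q t))\<^sup>2)
          \<le> lam * sinh 1 * sqrt (1 - (fst (q t))\<^sup>2)"
        using assms(2) square_le_1[OF t] by (intro mult_right_mono mult_left_mono) auto
      then show ?thesis by (simp only: eq)
    qed
    then have "\<forall>\<^sub>F t in at_top. norm (w t) \<le> lam * sinh 1 * sqrt (1 - (fst (q t))\<^sup>2)"
      by (rule eventually_at_top_linorderI)
    then show ?thesis using lim by (rule Lim_null_comparison)
  next
    case False
    \<comment> \<open>The motion stays at rotation angle pi, where sinh(q_0) = 0 makes the surface
      equation read w = 0.\<close>
    then have "w t = 0" if "t \<ge> t0" for t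
      using that by (simp add: surface(1)[OF that])
    then have "\<forall>\<^sub>F t in at_top. w t = 0"
      by (rule eventually_at_top_linorderI)
    then show ?thesis by (rule tendsto_eventually)
  qed
qed

lemma sliding_motion_not_unwinding:
  assumes "sliding_motion J lam u d t0 q w" "lam > 0"
  shows "\<not> unwinding t0 q"
proof (cases "fst (q t0) = 0")
  case True
  \<comment> \<open>The initial angle is exactly pi, so neither direction of rotation is shorter
    than pi and the first condition of \<open>unwinding\<close> fails.\<close>
  then show ?thesis by (simp add: unwinding_def rotation_angle_def)
next
  case False
  interpret sliding_scalar "\<lambda>t. fst (q t)" lam t0
    by (rule sliding_scalar_if_sliding_motion[OF assms])
  have angle: "\<bar>rotation_angle p - rotation_angle p'\<bar> = 2 * \<bar>arccos (fst p) - arccos (fst p')\<bar>"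
    for p p' :: quat
    by (simp add: rotation_angle_def abs_if)
  have "(\<Sum>i<n. \<bar>rotation_angle (q (\<tau> (Suc i))) - rotation_angle (q (\<tau> i))\<bar>) \<le> pi"
    if "mono \<tau>" "t0 \<le> \<tau> 0" for \<tau> :: "nat \<Rightarrow> real" and n
    using arccos_variation_le[OF False that, of n]
    unfolding angle sum_distrib_left[symmetric] by linarith
  then show ?thesis unfolding unwinding_def not_less[symmetric] by blast
qed

text \<open>At rest the gyroscopic term vanishes, so the equivalent control is \<open>- d t\<close>,
  which cancels the disturbance.\<close>

lemma sliding_equilibrium_at_pole:
  assumes "\<bar>c\<bar> = 1"
  shows "sliding_equilibrium J lam d t0 (c, 0) 0"
proof -
  have "c\<^sup>2 = 1" using assms by (simp add: abs_square_eq_1)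
  then have "sliding_motion J lam (\<lambda>t. - d t) d t0 (\<lambda>_. (c, 0)) (\<lambda>_. 0)"
    by (auto simp: sliding_motion_def attitude_error_dynamics_def unit_quat_def quat_rate_def
        switching_function_def zero_prod_def[symmetric] intro!: exI[of _ 0])
  then show ?thesis unfolding sliding_equilibrium_def by blast
qed

theorem theorem1:
  fixes J :: "real^3^3" and lam t0 :: real and d :: "real \<Rightarrow> real^3"
  assumes "transpose J = J"
    and "lam > 0"
  shows "(sliding_equilibrium J lam d t0 (1, 0) 0 \<and>
          sliding_equilibrium J lam d t0 (- 1, 0) 0 \<and>
          (\<forall>u q w. sliding_motion J lam u d t0 q w \<longrightarrow>
             (fst (q t0) \<noteq> 0 \<longrightarrow>
                ((\<lambda>t. fst (q t)) \<longlongrightarrow> 1) at_top \<or> ((\<lambda>t. fst (q t)) \<longlongrightarrow> - 1) at_top) \<and>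
             (w \<longlongrightarrow> 0) at_top)) \<and>
         (\<forall>u q w. sliding_motion J lam u d t0 q w \<longrightarrow> \<not> unwinding t0 q)"
proof (intro conjI allI impI)
  show "sliding_equilibrium J lam d t0 (1, 0) 0" "sliding_equilibrium J lam d t0 (- 1, 0) 0"
    by (simp_all add: sliding_equilibrium_at_pole)
next
  fix u q w assume motion: "sliding_motion J lam u d t0 q w"
  show "((\<lambda>t. fst (q t)) \<longlongrightarrow> 1) at_top \<or> ((\<lambda>t. fst (q t)) \<longlongrightarrow> - 1) at_top"
    if "fst (q t0) \<noteq> 0"
    using sliding_scalar_if_sliding_motion[OF motion \<open>lam > 0\<close>] that
    by (rule sliding_scalar.tendsto_1_or_minus_1)
  show "(w \<longlongrightarrow> 0) at_top"
    using motion \<open>lam > 0\<close> by (rule sliding_motion_velocity_tendsto_0)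
  show "\<not> unwinding t0 q"
    using motion \<open>lam > 0\<close> by (rule sliding_motion_not_unwinding)
qed

end
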